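(* Let $R$ be a hemiring. The following assertions are equivalent: (1) Each $h$-ideal $A$ of $R$ is $h$-idempotent, i.e. $\overline{AA}=A$. (2) Each proper $h$-ideal of $R$ is semiprime.
   Context: A hemiring is a set $R$ with operations $+$ and $\cdot$ such that $(R,+)$ is a commutative semigroup, $(R,\cdot)$ is a semigroup, multiplication distributes over addition on both sides, and there is $0\in R$ with $a+0=0+a=a$ and $a0=0a=0$ for all $a\in R$. An $h$-ideal of $R$ is a non-empty subset $I$ closed under addition, with $ra,ar\in I$ for all $a\in I$, $r\in R$, and such that $x+a+y=b+y$ with $a,b\in I$, $x,y\in R$ implies $x\in I$. For subsets $A,B$, $AB$ is the set of finite sums of products $ab$ with $a\in A$, $b\in B$, and $B^2=BB$. The $h$-closure of a non-empty $A\subseteq R$ is $\overline{A}=\{x\in R\mid x+a+y=b+y\text{ for some }a,b\in A,\ y\in R\}$. An $h$-ideal $A$ is semiprime if $A\neq R$ and for any $h$-ideal $B$ of $R$, $B^2\subseteq A$ implies $B\subseteq A$. *)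

theory Defs
  imports Main
begin

text \<open>A hemiring is exactly a type of class \<^class>\<open>semiring_0\<close>; no multiplicative unit and no
  commutativity of multiplication is assumed. The hemiring is the whole type, \<^term>\<open>UNIV\<close>.\<close>

definition h_ideal :: "'a::semiring_0 set \<Rightarrow> bool" where
  "h_ideal I \<longleftrightarrow>
     I \<noteq> {} \<and>
     (\<forall>a\<in>I. \<forall>b\<in>I. a + b \<in> I) \<and>
     (\<forall>a\<in>I. \<forall>r. r * a \<in> I \<and> a * r \<in> I) \<and>
     (\<forall>x y. \<forall>a\<in>I. \<forall>b\<in>I. x + a + y = b + y \<longrightarrow> x \<in> I)"

text \<open>The empty sum is excluded; for h-ideals, which always contain \<open>0\<close>, this makes no difference.\<close>

definition set_product :: "'a::semiring_0 set \<Rightarrow> 'a set \<Rightarrow> 'a set" where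
  "set_product A B =
     {\<Sum>i<n. a i * b i | (n::nat) a b. n > 0 \<and> (\<forall>i<n. a i \<in> A \<and> b i \<in> B)}"

definition h_closure :: "'a::semiring_0 set \<Rightarrow> 'a set" where
  "h_closure A = {x. \<exists>a\<in>A. \<exists>b\<in>A. \<exists>y. x + a + y = b + y}"

definition h_idempotent :: "'a::semiring_0 set \<Rightarrow> bool" where
  "h_idempotent A \<longleftrightarrow> h_closure (set_product A A) = A"

definition h_semiprime :: "'a::semiring_0 set \<Rightarrow> bool" where
  "h_semiprime A \<longleftrightarrow>
     h_ideal A \<and> A \<noteq> UNIV \<and> (\<forall>B. h_ideal B \<longrightarrow> set_product B B \<subseteq> A \<longrightarrow> B \<subseteq> A)"

end

theory Submission
  imports Defs
begin

text \<open>The \<open>h\<close>-closure of \<open>AA\<close> is an \<open>h\<close>-ideal between \<open>AA\<close> and \<open>A\<close>. Hence if \<open>BB \<subseteq> A\<close>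
  and \<open>B\<close> is \<open>h\<close>-idempotent, then \<open>B\<close>, the closure of \<open>BB\<close>, lies in \<open>A\<close>; conversely, semiprimeness
  of the closure of \<open>AA\<close>, applied to the \<open>h\<close>-ideal \<open>A\<close>, gives \<open>A \<subseteq> \<close> closure of \<open>AA\<close>.\<close>

lemma set_productI:
  "(n::nat) > 0 \<Longrightarrow> (\<And>i. i < n \<Longrightarrow> a i \<in> A \<and> b i \<in> B) \<Longrightarrow> (\<Sum>i<n. a i * b i) \<in> set_product A B"
  unfolding set_product_def by blast

lemma set_productE:
  assumes "p \<in> set_product A B"
  obtains n :: nat and a b where "n > 0" "\<forall>i<n. a i \<in> A \<and> b i \<in> B" "p = (\<Sum>i<n. a i * b i)"
  using assms unfolding set_product_def by blast

lemma set_product_times: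
  assumes "x \<in> A" "y \<in> B"
  shows "x * y \<in> set_product A B"
  using set_productI[of 1 "\<lambda>_. x" A "\<lambda>_. y" B] assms by simp

lemma set_product_add_times:
  assumes "p \<in> set_product A B" "x \<in> A" "y \<in> B"
  shows "p + x * y \<in> set_product A B"
proof -
  obtain n :: nat and a b where "n > 0" and ab: "\<forall>i<n. a i \<in> A \<and> b i \<in> B" "p = (\<Sum>i<n. a i * b i)"
    using assms(1) by (rule set_productE)
  \<comment> \<open>Updating both families at index \<open>n\<close> leaves the first
    \<open>n\<close> summands alone and appends \<open>x * y\<close> as the last one.\<close>
  have "(\<Sum>i<Suc n. (a(n := x)) i * (b(n := y)) i) \<in> set_product A B"
    using ab(1) assms(2,3) by (intro set_productI) (auto simp: less_Suc_eq)
  then show ?thesis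
    by (simp add: ab(2))
qed

lemma set_product_add:
  assumes "p \<in> set_product A B" "q \<in> set_product A B"
  shows "p + q \<in> set_product A B"
proof -
  obtain n :: nat and a b where "n > 0" and ab: "\<forall>i<n. a i \<in> A \<and> b i \<in> B" "q = (\<Sum>i<n. a i * b i)"
    using assms(2) by (rule set_productE)
  \<comment> \<open>The summands of \<open>q\<close> are appended to \<open>p\<close> one at a time,
    which avoids concatenating index families. The empty sum at \<open>m = 0\<close> is harmless,
    since it leaves \<open>p\<close> itself.\<close>
  have "p + (\<Sum>i<m. a i * b i) \<in> set_product A B" if "m \<le> n" for m
    using that
  proof (induction m)
    case 0
    then show ?case using assms(1) by simp
  next
    case (Suc m)
    then show ?case
      using set_product_add_times[of "p + (\<Sum>i<m. a i * b i)" A B "a m" "b m"] ab(1)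
      by (simp add: add.assoc)
  qed
  then show ?thesis
    by (simp add: ab(2))
qed

lemma set_product_mult_left:
  assumes "p \<in> set_product A B" "\<And>x. x \<in> A \<Longrightarrow> r * x \<in> A"
  shows "r * p \<in> set_product A B"
proof -
  obtain n :: nat and a b where ab: "n > 0" "\<forall>i<n. a i \<in> A \<and> b i \<in> B" "p = (\<Sum>i<n. a i * b i)"
    using assms(1) by (rule set_productE)
  show ?thesis
    using set_productI[of n "\<lambda>i. r * a i" A b B] ab assms(2)
    by (simp add: sum_distrib_left mult.assoc)
qed

lemma set_product_mult_right:
  assumes "p \<in> set_product A B" "\<And>x. x \<in> B \<Longrightarrow> x * r \<in> B"
  shows "p * r \<in> set_product A B"
proof -
  obtain n :: nat and a b where ab: "n > 0" "\<forall>i<n. a i \<in> A \<and> b i \<in> B" "p = (\<Sum>i<n. a i * b i)"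
    using assms(1) by (rule set_productE)
  show ?thesis
    using set_productI[of n a A "\<lambda>i. b i * r" B] ab assms(2)
    by (simp add: sum_distrib_right mult.assoc)
qed

lemma h_closureI: "x + a + y = b + y \<Longrightarrow> a \<in> S \<Longrightarrow> b \<in> S \<Longrightarrow> x \<in> h_closure S"
  unfolding h_closure_def by blast

lemma subset_h_closure:
  assumes "\<And>a b. a \<in> S \<Longrightarrow> b \<in> S \<Longrightarrow> a + b \<in> S"
  shows "S \<subseteq> h_closure S"
proof
  fix x assume "x \<in> S"
  then show "x \<in> h_closure S"
    \<comment> \<open>The witnesses come from \<open>x + x + 0 = (x + x) + 0\<close>, so
      \<open>0\<close> need not lie in \<open>S\<close>.\<close>
    using assms by (intro h_closureI[of x x 0 "x + x"]) simp_all
qed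

lemma h_closure_mono: "S \<subseteq> T \<Longrightarrow> h_closure S \<subseteq> h_closure T"
  unfolding h_closure_def by blast

lemma h_closure_h_ideal:
  assumes "h_ideal A"
  shows "h_closure A \<subseteq> A"
  using assms unfolding h_ideal_def h_closure_def by blast

text \<open>Without subtraction, each closure property is obtained by adding or multiplying the
  witnessing equations so that the unwanted terms end up equal on both sides.\<close>

lemma h_ideal_h_closure:
  fixes S :: "'a::semiring_0 set"
  assumes "S \<noteq> {}"
    and add: "\<And>a b. a \<in> S \<Longrightarrow> b \<in> S \<Longrightarrow> a + b \<in> S"
    and left: "\<And>r a. a \<in> S \<Longrightarrow> r * a \<in> S"
    and right: "\<And>r a. a \<in> S \<Longrightarrow> a * r \<in> S"
  shows "h_ideal (h_closure S)"
  unfolding h_ideal_def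
proof (intro conjI ballI allI impI)
  show "h_closure S \<noteq> {}"
    using subset_h_closure[of S] add assms(1) by blast
next
  fix x x' assume "x \<in> h_closure S" "x' \<in> h_closure S"
  then obtain a b y a' b' y' where
    S: "a \<in> S" "b \<in> S" "a' \<in> S" "b' \<in> S" and eq: "x + a + y = b + y" "x' + a' + y' = b' + y'"
    unfolding h_closure_def by blast
  have "(x + x') + (a + a') + (y + y') = (x + a + y) + (x' + a' + y')"
    by (simp add: ac_simps)
  also have "\<dots> = (b + b') + (y + y')"
    unfolding eq by (simp add: ac_simps)
  finally show "x + x' \<in> h_closure S"
    by (rule h_closureI) (simp_all add: add S)
next
  fix x r assume "x \<in> h_closure S"
  then obtain a b y where S: "a \<in> S" "b \<in> S" and eq: "x + a + y = b + y"
    unfolding h_closure_def by blast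
  have "r * x + r * a + r * y = r * b + r * y"
    using arg_cong[OF eq, of "\<lambda>t. r * t"] by (simp add: distrib_left)
  then show "r * x \<in> h_closure S"
    by (rule h_closureI) (simp_all add: left S)
  have "x * r + a * r + y * r = b * r + y * r"
    using arg_cong[OF eq, of "\<lambda>t. t * r"] by (simp add: distrib_right)
  then show "x * r \<in> h_closure S"
    by (rule h_closureI) (simp_all add: right S)
next
  fix x y c d assume "c \<in> h_closure S" "d \<in> h_closure S" and x: "x + c + y = d + y"
  then obtain a b z a' b' z' where
    S: "a \<in> S" "b \<in> S" "a' \<in> S" "b' \<in> S" and c: "c + a + z = b + z" and d: "d + a' + z' = b' + z'"
    unfolding h_closure_def by blast
  \<comment> \<open>The terms \<open>c\<close> and \<open>d\<close> are only known to be in the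
    closure and must be eliminated: adding \<open>a + z\<close> trades \<open>c\<close> for
    \<open>b\<close>, and adding \<open>a' + z'\<close> trades \<open>d\<close> for
    \<open>b'\<close>. What remains are the witnesses \<open>b + a'\<close> and
    \<open>b' + a\<close> in \<open>S\<close>.\<close>
  have "x + (b + a') + (y + z + z') = x + (b + z) + a' + y + z'"
    by (simp add: ac_simps)
  also have "\<dots> = (x + c + y) + a + a' + z + z'"
    unfolding c[symmetric] by (simp add: ac_simps)
  also have "\<dots> = (d + a' + z') + a + y + z"
    unfolding x by (simp add: ac_simps)
  also have "\<dots> = (b' + a) + (y + z + z')"
    unfolding d by (simp add: ac_simps)
  finally show "x \<in> h_closure S"
    by (rule h_closureI) (simp_all add: add S)
qed

lemma set_product_subset_h_ideal:
  assumes "h_ideal A"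
  shows "set_product A A \<subseteq> A"
proof
  have add: "\<And>x y. x \<in> A \<Longrightarrow> y \<in> A \<Longrightarrow> x + y \<in> A"
    and mult: "\<And>x r. x \<in> A \<Longrightarrow> x * r \<in> A" and "A \<noteq> {}"
    using assms unfolding h_ideal_def by blast+
  \<comment> \<open>\<open>0\<close> is \<open>x * 0\<close> for any \<open>x\<close> in
    \<open>A\<close>; it starts the induction on partial sums below.\<close>
  then have zero: "0 \<in> A"
    by (metis ex_in_conv mult_zero_right)
  fix p assume "p \<in> set_product A A"
  then obtain n :: nat and a b where "n > 0" and ab: "\<forall>i<n. a i \<in> A \<and> b i \<in> A" "p = (\<Sum>i<n. a i * b i)"
    by (rule set_productE)
  have "(\<Sum>i<m. a i * b i) \<in> A" if "m \<le> n" for m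
    using that by (induction m) (auto simp: zero ab(1) intro!: add mult)
  then show "p \<in> A"
    by (simp add: ab(2))
qed

text \<open>A left multiplier is absorbed by the left factors of a sum of products and a right
  multiplier by the right factors, so \<open>AA\<close> meets the conditions of
  \<open>h_ideal_h_closure\<close>.\<close>

lemma h_ideal_h_closure_square:
  assumes "h_ideal A"
  shows "h_ideal (h_closure (set_product A A))"
proof (rule h_ideal_h_closure)
  show "set_product A A \<noteq> {}"
    using assms set_product_times[of _ A _ A] unfolding h_ideal_def by blast
  show "r * p \<in> set_product A A" "p * r \<in> set_product A A" if "p \<in> set_product A A" for p r
    using that assms set_product_mult_left[of p A A r] set_product_mult_right[of p A A r]
    unfolding h_ideal_def by blast+
qed (rule set_product_add)

theorem theorem6p4:
  "(\<forall>A :: 'a::semiring_0 set. h_ideal A \<longrightarrow> h_idempotent A) \<longleftrightarrow>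
   (\<forall>A :: 'a set. h_ideal A \<and> A \<noteq> UNIV \<longrightarrow> h_semiprime A)"
proof (intro iffI allI impI)
  fix A :: "'a set"
  assume idem: "\<forall>A :: 'a set. h_ideal A \<longrightarrow> h_idempotent A" and A: "h_ideal A \<and> A \<noteq> UNIV"
  \<comment> \<open>The chain is \<open>B = h_closure (set_product B B)\<close>, which lies in
    \<open>h_closure A\<close> and hence in \<open>A\<close>.\<close>
  have "B \<subseteq> A" if "h_ideal B" "set_product B B \<subseteq> A" for B
    using idem that A h_closure_mono[of "set_product B B" A] h_closure_h_ideal[of A]
    unfolding h_idempotent_def by blast
  then show "h_semiprime A"
    using A unfolding h_semiprime_def by blast
next
  fix A :: "'a set"
  let ?C = "h_closure (set_product A A)"
  assume semi: "\<forall>A :: 'a set. h_ideal A \<and> A \<noteq> UNIV \<longrightarrow> h_semiprime A" and A: "h_ideal A"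
  have "?C \<subseteq> A"
    using h_closure_mono[OF set_product_subset_h_ideal[OF A]] h_closure_h_ideal[OF A] by blast
  moreover have "A \<subseteq> ?C"
  \<comment> \<open>Semiprimeness is available only for proper h-ideals; if \<open>?C\<close> is
    everything, the inclusion is trivial.\<close>
  proof (cases "?C = UNIV")
    case False
    then have "h_semiprime ?C"
      using semi h_ideal_h_closure_square[OF A] by blast
    moreover have "set_product A A \<subseteq> ?C"
      by (intro subset_h_closure set_product_add)
    ultimately show ?thesis
      using A unfolding h_semiprime_def by blast
  qed simp
  ultimately show "h_idempotent A"
    unfolding h_idempotent_def by blast
qed

end
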